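(* Let $T$ be a caterpillar tree with stalk $v_0\to v_1\to\dots\to v_r$, $r\ge2$, rooted at $v_0$, one of the ends of the stalk, and let $1,m_1,m_2,\dots,m_{r-1},1$ be the degrees of the stalk vertices $v_0,v_1,\dots,v_r$. Then $$\frac{\psi(z)}{\theta(z)}=-z+\cfrac{1}{m_1z-\cfrac{m_1-2}{z}-\cfrac{1}{m_2z-\cfrac{m_2-2}{z}-\dots-\cfrac{1}{m_{r-1}z-\cfrac{m_{r-1}-1}{z}}}},$$ that is, $\psi(z)/\theta(z)=-z+1/F_1(z)$, where $F_{r-1}(z)=m_{r-1}z-\frac{m_{r-1}-1}{z}$ and $F_i(z)=m_iz-\frac{m_i-2}{z}-\frac{1}{F_{i+1}(z)}$ for $1\le i\le r-2$.
   Context: A caterpillar tree is a finite tree in which all vertices are within distance 1 of a central path, called the stalk. The stalk $v_0\to v_1\to\dots\to v_r$ is taken to be a longest path, so $d(v_0)=d(v_r)=1$, where $d(v)$ denotes the degree of $v$. Let $p$ be the number of vertices of $T$. Let $A$ be the adjacency matrix of $T$ with first row and column corresponding to the root $v_0$, and let $D$ be the diagonal matrix of the degrees of the vertices of $T$, in the same order. Let $A_1$ and $D_1$ be the principal submatrices of $A$ and $D$ obtained by deleting the first row and the first column (so $D_1$ contains the degrees in the original tree $T$). Then $$\psi(z)=\det(-zD+A),\qquad \theta(z)=\det(-zD_1+A_1).$$ *)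

theory Defs
  imports
    "HOL-Computational_Algebra.Polynomial_Factorial"
    "Graph_Theory.Graph_Theory"
    "Jordan_Normal_Form.Determinant"
begin

text \<open>
  Finite simple graphs are modelled by the locale predicate \<open>pair_graph\<close>, i.e. as finite symmetric
  loop-free digraphs whose arcs are pairs of vertices. The constant \<open>Digraph_Component.tree\<close> is not
  used: in a symmetric digraph it already counts the walk \<open>u, v, u\<close> along an edge as a cycle.
\<close>

definition undirected_cycle :: "'a pair_pre_digraph \<Rightarrow> 'a vwalk \<Rightarrow> bool" where
  "undirected_cycle G c \<longleftrightarrow>
     vpath c (with_proj G) \<and> 3 \<le> length c \<and> (last c, hd c) \<in> parcs G"

definition undirected_tree :: "'a pair_pre_digraph \<Rightarrow> bool" where
  "undirected_tree G \<longleftrightarrow>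
     pair_graph G \<and> Digraph_Component.connected (with_proj G) \<and> (\<nexists>c. undirected_cycle G c)"

definition vertex_degree :: "'a pair_pre_digraph \<Rightarrow> 'a \<Rightarrow> nat" where
  "vertex_degree G u = out_degree (with_proj G) u"

text \<open>A vertex is within distance 1 of a path if some walk of length at most 1 joins it to the path.\<close>

definition central_path :: "'a pair_pre_digraph \<Rightarrow> 'a vwalk \<Rightarrow> bool" where
  "central_path G p \<longleftrightarrow> vpath p (with_proj G) \<and>
     (\<forall>u\<in>pverts G. \<exists>q. vwalk q (with_proj G) \<and> hd q = u \<and> last q \<in> set p \<and> vwalk_length q \<le> 1)"

definition caterpillar :: "'a pair_pre_digraph \<Rightarrow> bool" where
  "caterpillar G \<longleftrightarrow> undirected_tree G \<and> (\<exists>p. central_path G p)"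

definition stalk :: "'a pair_pre_digraph \<Rightarrow> 'a vwalk \<Rightarrow> bool" where
  "stalk G p \<longleftrightarrow> central_path G p \<and>
     (\<forall>q. vpath q (with_proj G) \<longrightarrow> vwalk_length q \<le> vwalk_length p)"

text \<open>
  The list \<open>us\<close> enumerates the vertices in the order used for the rows and columns;
  its first entry is the root.
\<close>

definition adjacency_mat :: "'a pair_pre_digraph \<Rightarrow> 'a list \<Rightarrow> 'b::zero_neq_one mat" where
  "adjacency_mat G us =
     mat (length us) (length us) (\<lambda>(i, j). if (us ! i, us ! j) \<in> parcs G then 1 else 0)"

definition degree_mat :: "'a pair_pre_digraph \<Rightarrow> 'a list \<Rightarrow> 'b::semiring_1 mat" where
  "degree_mat G us = mat_diag (length us) (\<lambda>i. of_nat (vertex_degree G (us ! i)))"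

text \<open>
  The indeterminate \<open>z\<close> is the polynomial \<open>[:0, 1:]\<close>. In \<open>theta\<close> the root is deleted from the
  matrices, not from the graph, so the remaining diagonal entries are the degrees in \<open>G\<close>.
\<close>

definition psi :: "'a pair_pre_digraph \<Rightarrow> 'a list \<Rightarrow> complex poly" where
  "psi G us = det ((- [:0, 1:]) \<cdot>\<^sub>m degree_mat G us + adjacency_mat G us)"

definition theta :: "'a pair_pre_digraph \<Rightarrow> 'a list \<Rightarrow> complex poly" where
  "theta G us =
     det ((- [:0, 1:]) \<cdot>\<^sub>m mat_delete (degree_mat G us) 0 0 + mat_delete (adjacency_mat G us) 0 0)"

text \<open>The indeterminate as an element of the field of rational functions.\<close>

definition zvar :: "complex poly fract" where
  "zvar = to_fract [:0, 1:]"

text \<open>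
  \<open>cfrac m r i\<close> is the tail of the continued fraction starting at level \<open>i\<close>, for \<open>1 \<le> i \<le> r - 1\<close>.
\<close>

function cfrac :: "(nat \<Rightarrow> nat) \<Rightarrow> nat \<Rightarrow> nat \<Rightarrow> complex poly fract" where
  "cfrac m r i =
     (if i < r - 1
      then of_nat (m i) * zvar - (of_nat (m i) - 2) / zvar - 1 / cfrac m r (i + 1)
      else of_nat (m i) * zvar - (of_nat (m i) - 1) / zvar)"
  by auto
termination by (relation "measure (\<lambda>(m, r, i). r - i)") auto

declare cfrac.simps [simp del]

end

theory Submission
  imports Defs
begin

text \<open>
  By Cramer's rule, a vector \<open>x\<close> over the field of rational functions with \<open>x = 1\<close> at the root and
  \<open>(A - z D) x = c e\<close>, where \<open>e\<close> is the unit vector of the root, gives \<open>\<psi> = c \<theta>\<close>. Since every vertex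
  other than \<open>v 0, \<dots>, v (r - 1)\<close> is a leaf hanging from the interior of the stalk, such an \<open>x\<close> can be
  written down by moving along the stalk; the ratio of consecutive entries is the tail \<open>F i\<close> of the
  continued fraction, and \<open>c = - z + 1 / F 1\<close>. The quotients make sense because each \<open>F i\<close> has degree 1
  as a rational function, and because in \<open>- z D\<^sub>1 + A\<^sub>1\<close> the diagonal dominates in degree.
\<close>

section \<open>Two determinant criteria: degree dominance and Cramer's rule\<close>

text \<open>Polynomial analogue of strict diagonal dominance: if \<open>w\<close> is a kernel vector
  and \<open>w $ k\<close> has the largest degree among its nonzero entries, the diagonal term of
  row \<open>k\<close> has larger degree than the others, so the row cannot sum to zero.\<close>

lemma det_nonzero_if_degree_dominant:
  fixes A :: "'a :: idom poly mat"
  assumes A: "A \<in> carrier_mat n n"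
    and dom: "\<And>i j. i < n \<Longrightarrow> j < n \<Longrightarrow> j \<noteq> i \<Longrightarrow> degree (A $$ (i, j)) < degree (A $$ (i, i))"
    and diag: "\<And>i. i < n \<Longrightarrow> A $$ (i, i) \<noteq> 0"
  shows "det A \<noteq> 0"
proof
  assume "det A = 0"
  then obtain w where w: "w \<in> carrier_vec n" "w \<noteq> 0\<^sub>v n" "A *\<^sub>v w = 0\<^sub>v n"
    using det_0_iff_vec_prod_zero[OF A] by blast
  define S where "S = {i. i < n \<and> w $ i \<noteq> 0}"
  have "S \<noteq> {}"
    using w(1,2) by (auto simp: S_def vec_eq_iff)
  moreover have "finite S"
    by (simp add: S_def)
  ultimately obtain k where k: "k \<in> S" "\<And>j. j \<in> S \<Longrightarrow> degree (w $ j) \<le> degree (w $ k)"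
    using finite_has_maximal[of "(\<lambda>j. degree (w $ j)) ` S"] by (smt (verit) finite_imageI image_iff image_is_empty nat_le_linear)
  have kn: "k < n" "w $ k \<noteq> 0"
    using k(1) by (auto simp: S_def)
  have "(A *\<^sub>v w) $ k = (\<Sum>j\<in>{0..<n}. A $$ (k, j) * w $ j)"
    using A w(1) kn(1) by (auto simp: scalar_prod_def intro!: sum.cong)
  then have "0 = (\<Sum>j\<in>{0..<n}. A $$ (k, j) * w $ j)"
    using w(3) kn(1) by simp
  also have "\<dots> = A $$ (k, k) * w $ k + (\<Sum>j\<in>{0..<n} - {k}. A $$ (k, j) * w $ j)"
    using kn(1) by (subst sum.remove[of _ k]) auto
  finally have eq: "A $$ (k, k) * w $ k = - (\<Sum>j\<in>{0..<n} - {k}. A $$ (k, j) * w $ j)"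
    by (simp add: eq_neg_iff_add_eq_0)
  have Akk: "A $$ (k, k) * w $ k \<noteq> 0"
    using diag[OF kn(1)] kn(2) by simp
  have deg_kk: "degree (A $$ (k, k) * w $ k) = degree (A $$ (k, k)) + degree (w $ k)"
    using diag[OF kn(1)] kn(2) by (simp add: degree_mult_eq)
  \<comment> \<open>The zero polynomial has degree 0, so the strict bounds below need a diagonal
    entry of positive degree; \<open>dom\<close> yields it from any off-diagonal index.\<close>
  have "\<exists>j\<in>{0..<n} - {k}. A $$ (k, j) * w $ j \<noteq> 0"
  proof (rule ccontr)
    assume "\<not> ?thesis"
    then have "(\<Sum>j\<in>{0..<n} - {k}. A $$ (k, j) * w $ j) = 0"
      by (intro sum.neutral) blast
    then show False
      using eq Akk by simp
  qed
  then obtain j0 where j0: "j0 < n" "j0 \<noteq> k"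
    by (metis DiffE atLeastLessThan_iff insertI1)
  have pos: "0 < degree (A $$ (k, k))"
    using dom[OF kn(1) j0] by simp
  have terms: "degree (A $$ (k, j) * w $ j) < degree (A $$ (k, k)) + degree (w $ k)"
    if "j \<in> {0..<n} - {k}" for j
  proof (cases "w $ j = 0")
    case False
    then have "degree (w $ j) \<le> degree (w $ k)"
      using that k(2) by (auto simp: S_def)
    then show ?thesis
      using dom[OF kn(1), of j] that degree_mult_le[of "A $$ (k, j)" "w $ j"] by auto
  qed (use pos in simp)
  have "degree (\<Sum>j\<in>{0..<n} - {k}. A $$ (k, j) * w $ j) < degree (A $$ (k, k)) + degree (w $ k)"
    by (rule degree_sum_less) (use terms pos in auto)
  then show False
    using eq deg_kk by simp
qed

text \<open>Replacing column \<open>k\<close> by the product of \<open>A\<close> and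
  \<open>x\<close> multiplies the determinant by \<open>x $ k\<close> (Cramer). The new column is
  \<open>c\<close> times a unit vector, so Laplace expansion leaves one cofactor.\<close>

lemma det_mult_eq_cofactor_mult:
  fixes A :: "'a :: comm_ring_1 mat"
  assumes A: "A \<in> carrier_mat n n" and x: "x \<in> carrier_vec n" and k: "k < n"
    and Ax: "A *\<^sub>v x = c \<cdot>\<^sub>v unit_vec n k"
  shows "x $ k * det A = c * cofactor A k k"
proof -
  let ?B = "replace_col A (A *\<^sub>v x) k"
  have B: "?B \<in> carrier_mat n n"
    using A by (simp add: replace_col_def)
  have "x $ k * det A = det ?B"
    using cramer_lemma_mat[OF A x k] by simp
  also have "\<dots> = (\<Sum>i<n. ?B $$ (i, k) * cofactor ?B i k)"
    by (rule laplace_expansion_column[OF B k])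
  also have "\<dots> = (\<Sum>i<n. if i = k then c * cofactor ?B k k else 0)"
    using A k by (intro sum.cong) (auto simp: replace_col_def Ax)
  also have "\<dots> = c * cofactor ?B k k"
    using k by simp
  also have "mat_delete ?B k k = mat_delete A k k"
    using A by (intro eq_matI) (auto simp: replace_col_def mat_delete_def)
  then have "cofactor ?B k k = cofactor A k k"
    by (simp add: cofactor_def)
  finally show ?thesis .
qed

section \<open>Degrees of the continued fraction tails\<close>

interpretation to_fract_hom: inj_comm_ring_hom "to_fract :: 'a :: idom \<Rightarrow> 'a fract"
  by unfold_locales auto

lemma zvar_nonzero: "zvar \<noteq> 0"
  by (simp add: zvar_def)

text \<open>The term \<open>of_nat (m i) * zvar\<close> dominates, the others having degree at most
  -1. Mere nonvanishing of the next tail would not control its inverse, hence the induction on the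
  exact degree.\<close>

lemma cfrac_degree_one:
  assumes "i < r" and "\<And>j. i \<le> j \<Longrightarrow> j < r \<Longrightarrow> m j \<noteq> 0"
  shows "\<exists>P Q. cfrac m r i = to_fract P / to_fract Q \<and> Q \<noteq> 0 \<and> degree P = Suc (degree Q)"
  using assms
proof (induction m r i rule: cfrac.induct)
  case (1 m r i)
  define Z :: "complex poly" where "Z = [:0, 1:]"
  have Z: "to_fract Z = zvar" "Z \<noteq> 0" "degree Z = 1"
    by (simp_all add: Z_def zvar_def)
  have m: "m i \<noteq> 0"
    using "1.prems" by simp
  \<comment> \<open>\<open>A c\<close> is \<open>Z\<close> times
    \<open>m i * z - (m i - c) / z\<close>; \<open>c = 2\<close> serves the levels below
    \<open>r - 1\<close> and \<open>c = 1\<close> the last one.\<close>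
  define A where "A c = of_nat (m i) * Z ^ 2 - (of_nat (m i) - c)" for c :: "complex poly"
  have degA: "degree (A (of_nat c)) = 2" for c
  proof -
    have "A (of_nat c) = [:of_nat c - of_nat (m i), 0, of_nat (m i):]"
      by (simp add: A_def Z_def of_nat_poly power2_eq_square)
    then show ?thesis using m by simp
  qed
  have fractA: "to_fract (A (of_nat c)) = of_nat (m i) * zvar ^ 2 - (of_nat (m i) - of_nat c)" for c
    by (simp add: A_def hom_distribs power2_eq_square flip: Z(1))
  show ?case
  proof (cases "i < r - 1")
    case True
    then obtain P Q where PQ: "cfrac m r (i + 1) = to_fract P / to_fract Q" "Q \<noteq> 0"
        "degree P = Suc (degree Q)"
      using "1.IH" "1.prems" by force
    have P: "P \<noteq> 0"
      using PQ(3) by auto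
    have "A (of_nat 2) \<noteq> 0"
      using degA[of 2] by (metis degree_0 zero_neq_numeral)
    then have "degree (A (of_nat 2) * P) = 2 + degree P"
      using degA[of 2] P by (simp add: degree_mult_eq)
    \<comment> \<open>\<open>Z * Q\<close> has the same degree as \<open>P\<close>, so it cannot
      cancel the leading term of \<open>A (of_nat 2) * P\<close>.\<close>
    moreover have "degree (- (Z * Q)) < 2 + degree P"
      using Z PQ(2,3) by (simp add: degree_mult_eq)
    ultimately have deg: "degree (A (of_nat 2) * P - Z * Q) = 2 + degree P"
      using degree_add_eq_left[of "- (Z * Q)" "A (of_nat 2) * P"] by simp
    have "cfrac m r i = of_nat (m i) * zvar - (of_nat (m i) - of_nat 2) / zvar
        - 1 / (to_fract P / to_fract Q)"
      using True PQ(1) by (subst cfrac.simps) simp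
    also have "\<dots> = to_fract (A (of_nat 2) * P - Z * Q) / to_fract (Z * P)"
      unfolding to_fract_hom.hom_minus to_fract_hom.hom_mult fractA Z(1)
      using P PQ(2) zvar_nonzero by (simp add: field_simps power2_eq_square)
    finally show ?thesis
      using deg Z P by (intro exI[of _ "A (of_nat 2) * P - Z * Q"] exI[of _ "Z * P"]) (simp add: degree_mult_eq)
  next
    case False
    have "cfrac m r i = of_nat (m i) * zvar - (of_nat (m i) - of_nat 1) / zvar"
      using False by (subst cfrac.simps) simp
    also have "\<dots> = to_fract (A (of_nat 1)) / to_fract Z"
      unfolding fractA Z(1) using zvar_nonzero by (simp add: field_simps power2_eq_square)
    finally show ?thesis
      using degA[of 1] Z by (intro exI[of _ "A (of_nat 1)"] exI[of _ Z]) simp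
  qed
qed

lemma cfrac_nonzero:
  assumes "i < r" and "\<And>j. i \<le> j \<Longrightarrow> j < r \<Longrightarrow> m j \<noteq> 0"
  shows "cfrac m r i \<noteq> 0"
  using cfrac_degree_one[OF assms] by force

section \<open>Neighbourhoods in a caterpillar\<close>

definition neighbours :: "'a pair_pre_digraph \<Rightarrow> 'a \<Rightarrow> 'a set" where
  "neighbours G u = {w. (u, w) \<in> parcs G}"

lemma vertex_degree_eq_card_neighbours: "vertex_degree G u = card (neighbours G u)"
proof -
  have "out_arcs (with_proj G) u = Pair u ` neighbours G u"
    by (auto simp: out_arcs_def neighbours_def)
  then show ?thesis
    by (simp add: vertex_degree_def out_degree_def card_image inj_on_def)
qed

locale rooted_caterpillar = pair_graph T
  for T :: "'a pair_pre_digraph" +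
  fixes v :: "nat \<Rightarrow> 'a" and r :: nat and m :: "nat \<Rightarrow> nat"
  assumes caterpillar_T: "caterpillar T"
    and stalk_v: "stalk T (map v [0..<r + 1])"
    and r_ge_2: "2 \<le> r"
    and m_degree: "\<And>i. 1 \<le> i \<Longrightarrow> i < r \<Longrightarrow> m i = vertex_degree T (v i)"
begin

lemma arc_sym: "(a, b) \<in> parcs T \<Longrightarrow> (b, a) \<in> parcs T"
  using arcs_symmetric by blast

lemma no_undirected_cycle: "\<not> undirected_cycle T c"
  using caterpillar_T by (auto simp: caterpillar_def undirected_tree_def)

lemma stalk_vpath: "vpath (map v [0..<Suc r]) (with_proj T)"
  using stalk_v by (simp add: stalk_def central_path_def)

text \<open>The form in which maximality of the stalk is used; list length exceeds
  \<open>vwalk_length\<close> by one.\<close>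

lemma vpath_length_le: "vpath q (with_proj T) \<Longrightarrow> length q \<le> Suc r"
  using stalk_v by (fastforce simp: stalk_def)

lemma inj_stalk: "inj_on v {0..<Suc r}"
  using stalk_vpath by (simp add: vpath_def distinct_map del: upt_Suc)

lemma stalk_eq_iff: "i \<le> r \<Longrightarrow> j \<le> r \<Longrightarrow> v i = v j \<longleftrightarrow> i = j"
  using inj_stalk by (auto simp: inj_on_def)

text \<open>Supplies the stalk part of every cycle ruled out below.\<close>

lemma stalk_segment:
  assumes "i \<le> j" "j \<le> r"
  shows "vpath (map v [i..<Suc j]) (with_proj T)"
proof -
  have "map v [0..<Suc r] = map v [0..<i] @ map v [i..<Suc j] @ map v [Suc j..<Suc r]"
    using assms upt_add_eq_append[of 0 i "Suc j - i"] upt_add_eq_append[of 0 "Suc j" "r - j"]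
    by (simp del: upt_Suc)
  then have "vwalk (map v [i..<Suc j]) (with_proj T)"
    using stalk_vpath assms
      vwalkI_append_r[of "map v [i..<Suc j] @ map v [Suc j..<Suc r]" "map v [0..<i]" "with_proj T"]
      vwalkI_append_l[of "map v [i..<Suc j]" "map v [Suc j..<Suc r]" "with_proj T"]
    by (simp add: vpath_def del: upt_Suc)
  moreover have "distinct (map v [i..<Suc j])"
    using assms by (auto simp: distinct_map simp del: upt_Suc intro: inj_on_subset[OF inj_stalk])
  ultimately show ?thesis
    by (simp add: vpath_def)
qed

lemma stalk_arc: "i < r \<Longrightarrow> (v i, v (Suc i)) \<in> parcs T"
  using stalk_segment[of i "Suc i"] by (simp add: vpath_def vwalk_def)

lemma stalk_vertex: "i \<le> r \<Longrightarrow> v i \<in> pverts T"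
  using stalk_segment[of i i] by (simp add: vpath_def vwalk_def)

lemma hd_last_segment:
  assumes "i \<le> j"
  shows "hd (map v [i..<Suc j]) = v i" and "last (map v [i..<Suc j]) = v j"
    and "set (map v [i..<Suc j]) = v ` {i..j}" and "map v [i..<Suc j] \<noteq> []"
  using assms by (auto simp: hd_map last_map simp del: upt_Suc)

lemma vpath_Cons:
  assumes "vpath p (with_proj T)" "(u, hd p) \<in> parcs T" "u \<notin> set p"
  shows "vpath (u # p) (with_proj T)"
  using assms vwalk_wf_digraph_consI[of p u] by (auto simp: vpath_def)

text \<open>A chord would close the segment between its ends, which has at least three vertices, to
  a cycle.\<close>

lemma no_chord:
  assumes "i < j" "j \<le> r" "(v i, v j) \<in> parcs T"
  shows "j = Suc i"
proof (rule ccontr)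
  assume "j \<noteq> Suc i"
  then have "undirected_cycle T (map v [i..<Suc j])"
    using assms stalk_segment[of i j] hd_last_segment[of i j] arc_sym[OF assms(3)]
    by (simp add: undirected_cycle_def del: upt_Suc)
  then show False
    using no_undirected_cycle by blast
qed

lemma stalk_arc_iff:
  assumes "i \<le> r" "j \<le> r"
  shows "(v i, v j) \<in> parcs T \<longleftrightarrow> j = Suc i \<or> i = Suc j"
proof
  assume arc: "(v i, v j) \<in> parcs T"
  then have "i \<noteq> j"
    using no_loops' by blast
  then show "j = Suc i \<or> i = Suc j"
    using no_chord[of i j] no_chord[of j i] arc arc_sym[OF arc] assms by linarith
next
  assume "j = Suc i \<or> i = Suc j"
  then show "(v i, v j) \<in> parcs T"
    using assms stalk_arc[of i] arc_sym[OF stalk_arc[of j]] by fastforce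
qed

text \<open>The walk of length at most 1 from \<open>u\<close> to the stalk has one or two vertices;
  a single one would put \<open>u\<close> on the stalk.\<close>

lemma off_stalk_adjacent:
  assumes "u \<in> pverts T" "u \<notin> v ` {..r}"
  shows "\<exists>j\<le>r. (u, v j) \<in> parcs T"
proof -
  obtain q where q: "vwalk q (with_proj T)" "hd q = u" "last q \<in> set (map v [0..<r + 1])"
      "length q \<le> 2"
    using stalk_v assms(1) by (force simp: stalk_def central_path_def)
  have last: "last q \<in> v ` {..r}"
    using q(3) by (auto simp: less_Suc_eq_le)
  obtain b where "q = [u, b]"
  proof (cases q)
    case Nil
    then show ?thesis
      using q(1) by auto
  next
    case (Cons a q')
    then show ?thesis
      using q(2,4) last assms(2) that by (cases q') auto
  qed
  then show ?thesis
    using q(1) last by (auto simp: vwalk_def)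
qed

text \<open>The segment between two stalk neighbours of \<open>u\<close> would close to a cycle
  through \<open>u\<close>.\<close>

lemma off_stalk_unique:
  assumes "u \<notin> v ` {..r}" "(u, v j) \<in> parcs T" "(u, v k) \<in> parcs T" "j < k" "k \<le> r"
  shows False
proof -
  have "undirected_cycle T (u # map v [j..<Suc k])"
    using assms stalk_segment[of j k] hd_last_segment[of j k] arc_sym[OF assms(3)]
    by (auto simp: undirected_cycle_def simp del: upt_Suc intro!: vpath_Cons)
  then show False
    using no_undirected_cycle by blast
qed

text \<open>Both vertices have stalk neighbours, so the arc and the segment between these neighbours
  would form a cycle.\<close>

lemma off_stalk_independent:
  assumes u: "u \<notin> v ` {..r}" and w: "w \<notin> v ` {..r}" and arc: "(u, w) \<in> parcs T"
  shows False
proof -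
  \<comment> \<open>\<open>j = k\<close> is allowed and gives a triangle; the case
    \<open>k < j\<close> follows by exchanging the two vertices.\<close>
  have cycle: False
    if "a \<notin> v ` {..r}" "b \<notin> v ` {..r}" "(b, a) \<in> parcs T" "(a, v j) \<in> parcs T"
      "(b, v k) \<in> parcs T" "j \<le> k" "k \<le> r" for a b j k
  proof -
    have "vpath (a # map v [j..<Suc k]) (with_proj T)"
      using that stalk_segment[of j k] hd_last_segment[of j k]
      by (auto simp del: upt_Suc intro!: vpath_Cons)
    then have "vpath (b # a # map v [j..<Suc k]) (with_proj T)"
      using that hd_last_segment[of j k] no_loops'[of b a]
      by (auto simp del: upt_Suc intro!: vpath_Cons)
    then have "undirected_cycle T (b # a # map v [j..<Suc k])"
      using that hd_last_segment[of j k] arc_sym[of b "v k"]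
      by (auto simp: undirected_cycle_def simp del: upt_Suc)
    then show False
      using no_undirected_cycle by blast
  qed
  obtain j k where "j \<le> r" "(u, v j) \<in> parcs T" "k \<le> r" "(w, v k) \<in> parcs T"
    using off_stalk_adjacent u w in_arcsD1[OF arc] in_arcsD2[OF arc] by metis
  then show False
    using cycle[of u w j k] cycle[of w u k j] u w arc arc_sym[OF arc] by linarith
qed

text \<open>Otherwise attaching \<open>u\<close> at that end would give a path longer than the
  stalk.\<close>

lemma off_stalk_not_adjacent_ends:
  assumes u: "u \<notin> v ` {..r}" and j: "j \<le> r" and arc: "(u, v j) \<in> parcs T"
  shows "j \<noteq> 0" and "j \<noteq> r"
proof -
  let ?p = "map v [0..<Suc r]"
  show "j \<noteq> 0"
  proof
    assume "j = 0"
    then have "vpath (u # ?p) (with_proj T)"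
      using u arc stalk_vpath hd_last_segment[of 0 r] by (auto simp del: upt_Suc intro!: vpath_Cons)
    then show False
      using vpath_length_le[of "u # ?p"] by simp
  qed
  show "j \<noteq> r"
  proof
    assume "j = r"
    then have "vpath (?p @ [u]) (with_proj T)"
      using u stalk_vpath hd_last_segment[of 0 r] arc_sym[OF arc] in_arcsD1[OF arc]
      by (auto simp: vpath_def vwalk_def set_vwalk_arcs_snoc simp del: upt_Suc)
    then show False
      using vpath_length_le[of "?p @ [u]"] by simp
  qed
qed

lemma neighbours_root: "neighbours T (v 0) = {v 1}"
proof -
  have "w = v 1" if arc: "(v 0, w) \<in> parcs T" for w
  proof -
    have "w \<in> v ` {..r}"
      using off_stalk_not_adjacent_ends(1)[of w 0] arc_sym[OF arc] by auto
    then show ?thesis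
      using arc stalk_arc_iff[of 0] by auto
  qed
  moreover have "(v 0, v 1) \<in> parcs T"
    using stalk_arc[of 0] r_ge_2 by simp
  ultimately show ?thesis
    unfolding neighbours_def by blast
qed

text \<open>The far end \<open>v r\<close> is excluded from \<open>v ` {..<r}\<close> because it behaves like the leaves off the stalk.\<close>

lemma neighbours_leaf:
  assumes u: "u \<in> pverts T" "u \<notin> v ` {..<r}"
  shows "\<exists>j\<in>{1..<r}. neighbours T u = {v j}"
proof (cases "u = v r")
  case True
  have "w = v (r - 1)" if arc: "(v r, w) \<in> parcs T" for w
  proof -
    have "w \<in> v ` {..r}"
      using off_stalk_not_adjacent_ends(2)[of w r] arc_sym[OF arc] by auto
    then show ?thesis
      using arc stalk_arc_iff[of r] by auto
  qed
  moreover have "(v r, v (r - 1)) \<in> parcs T"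
    using stalk_arc_iff[of r "r - 1"] r_ge_2 by simp
  ultimately have "neighbours T u = {v (r - 1)}"
    unfolding neighbours_def True by blast
  then show ?thesis
    using r_ge_2 by (intro bexI[of _ "r - 1"]) auto
next
  case False
  then have off: "u \<notin> v ` {..r}"
    using u(2) by (auto simp: le_less)
  obtain j where j: "j \<le> r" "(u, v j) \<in> parcs T"
    using off_stalk_adjacent[OF u(1) off] by blast
  have "w = v j" if arc: "(u, w) \<in> parcs T" for w
  proof -
    obtain k where "k \<le> r" "w = v k"
      using off_stalk_independent[OF off _ arc] by blast
    then show ?thesis
      using off_stalk_unique[OF off j(2), of k] off_stalk_unique[OF off _ j(2), of k] arc j(1)
      by (cases k j rule: linorder_cases) auto
  qed
  then have "neighbours T u = {v j}"
    unfolding neighbours_def using j(2) by blast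
  moreover have "j \<in> {1..<r}"
    using j(1) off_stalk_not_adjacent_ends[OF off j] by simp
  ultimately show ?thesis
    by blast
qed

text \<open>As \<open>v r\<close> counts as a leaf, level \<open>r - 1\<close> has one non-leaf
  neighbour and the lower levels have two; this is the origin of the numerators
  \<open>m i - 1\<close> and \<open>m i - 2\<close> in \<open>cfrac\<close>.\<close>

lemma neighbours_inner:
  assumes "1 \<le> i" "i < r"
  shows "neighbours T (v i) \<inter> v ` {..<r} = (if i < r - 1 then {v (i - 1), v (i + 1)} else {v (i - 1)})"
proof -
  have "v k \<in> neighbours T (v i) \<longleftrightarrow> k = i - 1 \<or> k = i + 1" if "k < r" for k
    using stalk_arc_iff[of i k] that assms by (auto simp: neighbours_def)
  then have "neighbours T (v i) \<inter> v ` {..<r} = v ` {k. k < r \<and> (k = i - 1 \<or> k = i + 1)}"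
    by auto
  also have "{k. k < r \<and> (k = i - 1 \<or> k = i + 1)} = (if i < r - 1 then {i - 1, i + 1} else {i - 1})"
    using assms by auto
  finally show ?thesis
    by (simp split: if_splits)
qed

lemma finite_neighbours: "finite (neighbours T u)"
  by (rule finite_subset[OF _ pair_finite_verts]) (auto simp: neighbours_def dest: in_arcsD2)

text \<open>Serves both nonvanishing arguments: for the coefficients \<open>m j\<close> of the tails
  and for the diagonal of the matrix in \<open>theta\<close>.\<close>

lemma vertex_degree_pos:
  assumes "u \<in> pverts T"
  shows "0 < vertex_degree T u"
proof -
  have "neighbours T u \<noteq> {}"
  proof (cases "u \<in> v ` {..<r}")
    case True
    then show ?thesis
      using stalk_arc by (auto simp: neighbours_def)
  next
    case False
    then show ?thesis
      using neighbours_leaf[OF assms] by auto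
  qed
  then show ?thesis
    by (simp add: vertex_degree_eq_card_neighbours card_gt_0_iff finite_neighbours)
qed

section \<open>Weights on the vertices that solve the linear system\<close>

abbreviation F :: "nat \<Rightarrow> complex poly fract" where
  "F i \<equiv> cfrac m r i"

lemma F_nonzero: "1 \<le> i \<Longrightarrow> i < r \<Longrightarrow> F i \<noteq> 0"
  using vertex_degree_pos stalk_vertex by (intro cfrac_nonzero) (force simp: m_degree)+

text \<open>Product form of the recursion \<open>y 0 = 1\<close>,
  \<open>y (i - 1) = F i * y i\<close>.\<close>

definition stalk_weight :: "nat \<Rightarrow> complex poly fract" where
  "stalk_weight i = (\<Prod>j\<in>{1..i}. 1 / F j)"

lemma stalk_weight_0: "stalk_weight 0 = 1"
  by (simp add: stalk_weight_def)

lemma stalk_weight_Suc: "stalk_weight (Suc i) = stalk_weight i / F (Suc i)"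
  by (simp add: stalk_weight_def)

text \<open>
  The equation at a leaf expresses its entry by that of its neighbour; the equation at \<open>v i\<close> then
  amounts to \<open>x (v (i - 1)) = F i * x (v i)\<close>.
\<close>

definition vertex_weight :: "'a \<Rightarrow> complex poly fract" where
  "vertex_weight u =
     (if u \<in> v ` {..<r} then stalk_weight (THE i. i < r \<and> u = v i)
      else stalk_weight (THE i. i < r \<and> neighbours T u = {v i}) / zvar)"

lemma vertex_weight_stalk:
  assumes "i < r"
  shows "vertex_weight (v i) = stalk_weight i"
proof -
  have "(THE k. k < r \<and> v i = v k) = i"
    using assms by (intro the_equality) (auto simp: stalk_eq_iff)
  then show ?thesis
    using assms by (simp add: vertex_weight_def)
qed

lemma vertex_weight_leaf:
  assumes "u \<notin> v ` {..<r}" "i < r" "neighbours T u = {v i}"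
  shows "vertex_weight u = stalk_weight i / zvar"
proof -
  have "(THE k. k < r \<and> neighbours T u = {v k}) = i"
    using assms by (intro the_equality) (auto simp: stalk_eq_iff)
  then show ?thesis
    using assms(1) by (simp add: vertex_weight_def)
qed

text \<open>A leaf has degree 1 and carries the weight of its neighbour divided by
  \<open>zvar\<close>.\<close>

lemma vertex_weight_sum_leaf:
  assumes "u \<in> pverts T" "u \<notin> v ` {..<r}"
  shows "sum vertex_weight (neighbours T u) = zvar * of_nat (vertex_degree T u) * vertex_weight u"
proof -
  obtain i where i: "i < r" "neighbours T u = {v i}"
    using neighbours_leaf[OF assms] by auto
  then show ?thesis
    using assms(2) zvar_nonzero
    by (simp add: vertex_weight_stalk vertex_weight_leaf vertex_degree_eq_card_neighbours)
qed

text \<open>With \<open>y\<close> for \<open>stalk_weight\<close>, the stalk neighbours contribute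
  \<open>F i * y i\<close> and, below level \<open>r - 1\<close>, \<open>y i / F (i + 1)\<close>;
  each leaf contributes \<open>y i / zvar\<close>. The balance at \<open>v i\<close> is then the
  defining recursion of \<open>F i\<close>.\<close>

lemma vertex_weight_sum_inner:
  assumes i: "1 \<le> i" "i < r"
  shows "sum vertex_weight (neighbours T (v i)) = zvar * of_nat (m i) * vertex_weight (v i)"
proof -
  let ?N = "neighbours T (v i)" and ?S = "v ` {..<r}" and ?y = stalk_weight
  note N_inter = neighbours_inner[OF i]
  \<comment> \<open>Such a \<open>w\<close> is a leaf, and its only neighbour must be
    \<open>v i\<close>.\<close>
  have leaf: "vertex_weight w = ?y i / zvar" if w: "w \<in> ?N - ?S" for w
  proof -
    have arc: "(v i, w) \<in> parcs T" and off: "w \<notin> ?S"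
      using w by (auto simp: neighbours_def)
    obtain j where j: "neighbours T w = {v j}"
      using neighbours_leaf[OF in_arcsD2[OF arc] off] by blast
    moreover have "v i \<in> neighbours T w"
      using arc_sym[OF arc] by (simp add: neighbours_def)
    ultimately show ?thesis
      using vertex_weight_leaf[OF off i(2)] by simp
  qed
  have "card (?N \<inter> ?S) + card (?N - ?S) = card ?N"
    using finite_neighbours by (metis Int_Diff_Un Int_Diff_disjoint card_Un_disjoint finite_Diff finite_Int)
  then have "card (?N \<inter> ?S) + card (?N - ?S) = m i"
    using i by (simp add: m_degree vertex_degree_eq_card_neighbours)
  \<comment> \<open>The difference is formed in the field, as in \<open>cfrac\<close>, to avoid
    truncated subtraction.\<close>
  then have "of_nat (card (?N \<inter> ?S)) + of_nat (card (?N - ?S)) = (of_nat (m i) :: complex poly fract)"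
    by (metis of_nat_add)
  then have card: "of_nat (card (?N - ?S)) = (of_nat (m i) - of_nat (card (?N \<inter> ?S)) :: complex poly fract)"
    by (simp add: eq_diff_eq add.commute)
  have "sum vertex_weight ?N = sum vertex_weight (?N \<inter> ?S) + sum vertex_weight (?N - ?S)"
    using finite_neighbours by (rule sum.Int_Diff)
  also have "sum vertex_weight (?N - ?S) = (of_nat (m i) - of_nat (card (?N \<inter> ?S))) * (?y i / zvar)"
    using leaf by (simp add: card)
  finally have sum: "sum vertex_weight ?N = sum vertex_weight (?N \<inter> ?S)
      + (of_nat (m i) - of_nat (card (?N \<inter> ?S))) * (?y i / zvar)" .
  have prev: "?y (i - 1) = F i * ?y i"
    using stalk_weight_Suc[of "i - 1"] F_nonzero[OF i] i(1) by simp
  show ?thesis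
  proof (cases "i < r - 1")
    case True
    have F: "F i = of_nat (m i) * zvar - (of_nat (m i) - 2) / zvar - 1 / F (Suc i)"
      using True by (subst cfrac.simps) simp
    \<comment> \<open>Needed for the intersection to have two elements.\<close>
    have "v (i - 1) \<noteq> v (i + 1)"
      using True i by (subst stalk_eq_iff) auto
    then have "sum vertex_weight ?N = F i * ?y i + ?y i / F (Suc i) + (of_nat (m i) - 2) * (?y i / zvar)"
      using True i prev by (simp add: sum N_inter vertex_weight_stalk stalk_weight_Suc[of i])
    also have "\<dots> = zvar * of_nat (m i) * ?y i"
      unfolding F by (simp add: algebra_simps diff_divide_distrib)
    finally show ?thesis
      using i by (simp add: vertex_weight_stalk)
  next
    case False
    have F: "F i = of_nat (m i) * zvar - (of_nat (m i) - 1) / zvar"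
      using False by (subst cfrac.simps) simp
    have "sum vertex_weight ?N = F i * ?y i + (of_nat (m i) - 1) * (?y i / zvar)"
      using False i prev by (simp add: sum N_inter vertex_weight_stalk)
    also have "\<dots> = zvar * of_nat (m i) * ?y i"
      unfolding F by (simp add: algebra_simps diff_divide_distrib)
    finally show ?thesis
      using i by (simp add: vertex_weight_stalk)
  qed
qed

lemma vertex_weight_root: "vertex_weight (v 0) = 1"
  using r_ge_2 by (simp add: vertex_weight_stalk stalk_weight_0)

text \<open>Row-by-row form of \<open>(A - z D) x = c e\<close>. Only the root fails to balance,
  having no predecessor on the stalk; its defect is \<open>x (v 1) - z\<close>.\<close>

lemma vertex_weight_equation:
  assumes u: "u \<in> pverts T"
  shows "sum vertex_weight (neighbours T u) - zvar * of_nat (vertex_degree T u) * vertex_weight u =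
    (if u = v 0 then - zvar + 1 / F 1 else 0)"
proof (cases "u \<in> v ` {..<r}")
  case True
  then obtain i where i: "i < r" "u = v i"
    by auto
  show ?thesis
  proof (cases "i = 0")
    case True
    have "vertex_weight (v 1) = 1 / F 1"
      using r_ge_2 stalk_weight_Suc[of 0] by (simp add: vertex_weight_stalk stalk_weight_0)
    then show ?thesis
      using True i by (simp add: neighbours_root vertex_weight_root vertex_degree_eq_card_neighbours)
  next
    case False
    then show ?thesis
      using i stalk_eq_iff[of i 0] vertex_weight_sum_inner[of i] by (simp add: m_degree)
  qed
next
  case False
  moreover from this have "u \<noteq> v 0"
    using r_ge_2 by auto
  ultimately show ?thesis
    using vertex_weight_sum_leaf[OF u] by simp
qed

end

section \<open>The matrix \<open>A - z D\<close>: action on vectors, minor at the root, quotient of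
  determinants\<close>

definition pencil_mat :: "'a pair_pre_digraph \<Rightarrow> 'a list \<Rightarrow> complex poly mat" where
  "pencil_mat G us = (- [:0, 1:]) \<cdot>\<^sub>m degree_mat G us + adjacency_mat G us"

lemma pencil_mat_carrier: "pencil_mat G us \<in> carrier_mat (length us) (length us)"
  by (simp add: pencil_mat_def adjacency_mat_def degree_mat_def)

lemma pencil_mat_index:
  assumes "i < length us" "j < length us"
  shows "pencil_mat G us $$ (i, j) =
    (if i = j then - [:0, 1:] * of_nat (vertex_degree G (us ! i)) else 0)
      + (if (us ! i, us ! j) \<in> parcs G then 1 else 0)"
  using assms by (auto simp: pencil_mat_def adjacency_mat_def degree_mat_def mat_diag_def)

lemma psi_eq_det_pencil_mat: "psi G us = det (pencil_mat G us)"
  by (simp add: psi_def pencil_mat_def)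

text \<open>Deletion commutes with sums and scalar multiples, so \<open>theta\<close> is a principal
  minor of the matrix of \<open>psi\<close>, as Cramer's rule requires.\<close>

lemma theta_eq_det_mat_delete: "theta G us = det (mat_delete (pencil_mat G us) 0 0)"
  unfolding theta_def pencil_mat_def
  by (rule arg_cong[where f = det], rule eq_matI)
    (auto simp: mat_delete_def adjacency_mat_def degree_mat_def mat_diag_def)

text \<open>Distinctness of \<open>us\<close> turns the sum over positions into one over vertices;
  closure under arcs ensures that no neighbour is missed.\<close>

lemma pencil_mat_mult_vec:
  assumes "distinct us" "i < length us" "parcs G `` set us \<subseteq> set us"
  shows "(map_mat to_fract (pencil_mat G us) *\<^sub>v vec (length us) (\<lambda>j. x (us ! j))) $ i =
    sum x (neighbours G (us ! i)) - zvar * of_nat (vertex_degree G (us ! i)) * x (us ! i)"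
proof -
  let ?n = "length us" and ?d = "of_nat (vertex_degree G (us ! i)) :: complex poly fract"
  have "(map_mat to_fract (pencil_mat G us) *\<^sub>v vec ?n (\<lambda>j. x (us ! j))) $ i =
      (\<Sum>j<?n. to_fract (pencil_mat G us $$ (i, j)) * x (us ! j))"
    using assms(2) pencil_mat_carrier[of G us]
    by (auto simp: scalar_prod_def atLeast0LessThan intro!: sum.cong)
  also have "\<dots> = (\<Sum>j<?n. (if j = i then - zvar * ?d * x (us ! i) else 0)
      + (if us ! j \<in> neighbours G (us ! i) then x (us ! j) else 0))"
    using assms(2)
    by (intro sum.cong)
      (auto simp: pencil_mat_index neighbours_def zvar_def to_fract_hom.hom_add to_fract_hom.hom_mult
        to_fract_hom.hom_uminus to_fract_hom.hom_of_nat distrib_right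
        simp del: mult_pCons_left mult_minus_left minus_pCons)
  also have "\<dots> = - zvar * ?d * x (us ! i)
      + (\<Sum>j<?n. if us ! j \<in> neighbours G (us ! i) then x (us ! j) else 0)"
    using assms(2) by (simp add: sum.distrib)
  also have "(\<Sum>j<?n. if us ! j \<in> neighbours G (us ! i) then x (us ! j) else 0) =
      (\<Sum>w\<in>set us. if w \<in> neighbours G (us ! i) then x w else 0)"
    by (rule sum.reindex_bij_betw[OF bij_betw_nth[OF assms(1) refl refl]])
  also have "\<dots> = sum x (set us \<inter> neighbours G (us ! i))"
    by (simp add: sum.inter_restrict)
  also have "set us \<inter> neighbours G (us ! i) = neighbours G (us ! i)"
    using nth_mem[OF assms(2)] assms(3) by (auto simp: neighbours_def)
  finally show ?thesis
    by simp
qed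

text \<open>Off-diagonal entries are the constants 0 and 1, while diagonal entries have degree 1
  with minus the vertex degree as leading coefficient, so degree dominance applies.\<close>

lemma theta_nonzero:
  assumes "\<And>u. u \<in> set us \<Longrightarrow> 0 < vertex_degree G u"
  shows "theta G us \<noteq> 0"
  unfolding theta_eq_det_mat_delete
proof (rule det_nonzero_if_degree_dominant)
  let ?A = "mat_delete (pencil_mat G us) 0 0" and ?n = "length us - 1"
  show A: "?A \<in> carrier_mat ?n ?n"
    by (rule mat_delete_carrier[OF pencil_mat_carrier])
  have index: "?A $$ (i, j) = pencil_mat G us $$ (Suc i, Suc j)" if "i < ?n" "j < ?n" for i j
    using that pencil_mat_carrier[of G us] by (auto simp: mat_delete_def)
  have diag: "degree (?A $$ (i, i)) = 1" if i: "i < ?n" for i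
  proof -
    have "0 < vertex_degree G (us ! Suc i)"
      using i by (intro assms nth_mem) simp
    moreover have "?A $$ (i, i) = [:if (us ! Suc i, us ! Suc i) \<in> parcs G then 1 else 0,
        - of_nat (vertex_degree G (us ! Suc i)):]"
      using i by (simp add: index pencil_mat_index of_nat_poly one_pCons)
    ultimately show ?thesis
      by simp
  qed
  show "?A $$ (i, i) \<noteq> 0" if "i < ?n" for i
    using diag[OF that] by auto
  show "degree (?A $$ (i, j)) < degree (?A $$ (i, i))" if "i < ?n" "j < ?n" "j \<noteq> i" for i j
    using that by (simp add: diag) (simp add: index pencil_mat_index)
qed

text \<open>Since division by 0 yields 0, the first two conjuncts certify that the quotients by
  \<open>theta\<close> and by the tails are genuine.\<close>

theorem corollary3p2:
  fixes T :: "'a pair_pre_digraph" and v :: "nat \<Rightarrow> 'a" and r :: nat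
    and m :: "nat \<Rightarrow> nat" and us :: "'a list"
  assumes "caterpillar T"
    and "stalk T (map v [0..<r + 1])"
    and "r \<ge> 2"
    and "\<And>i. 1 \<le> i \<Longrightarrow> i \<le> r - 1 \<Longrightarrow> m i = vertex_degree T (v i)"
    and "distinct us" and "set us = pverts T" and "us ! 0 = v 0"
  shows "theta T us \<noteq> 0 \<and> (\<forall>i. 1 \<le> i \<and> i \<le> r - 1 \<longrightarrow> cfrac m r i \<noteq> 0) \<and>
    to_fract (psi T us) / to_fract (theta T us) = - zvar + 1 / cfrac m r 1"
proof -
  interpret pair_graph T
    using assms(1) by (simp add: caterpillar_def undirected_tree_def)
  interpret rooted_caterpillar T v r m
    using assms(1-4) by unfold_locales auto
  let ?n = "length us" and ?c = "- zvar + 1 / cfrac m r 1"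
  let ?M = "map_mat to_fract (pencil_mat T us) :: complex poly fract mat"
  let ?x = "vec ?n (\<lambda>j. vertex_weight (us ! j))"
  have theta: "theta T us \<noteq> 0"
    using vertex_degree_pos assms(6) by (intro theta_nonzero) simp
  have n: "0 < ?n"
    using stalk_vertex[of 0] assms(6) by (cases us) auto
  have M: "?M \<in> carrier_mat ?n ?n"
    using pencil_mat_carrier[of T us] by simp
  have "?M *\<^sub>v ?x = ?c \<cdot>\<^sub>v unit_vec ?n 0"
  proof (rule eq_vecI)
    fix i assume "i < dim_vec (?c \<cdot>\<^sub>v unit_vec ?n 0)"
    then have i: "i < ?n"
      by simp
    \<comment> \<open>By distinctness the root occupies row 0 only, matching the unit
      vector.\<close>
    have "us ! i = v 0 \<longleftrightarrow> i = 0"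
      using nth_eq_iff_index_eq[OF assms(5) i n] assms(7) by simp
    moreover have "us ! i \<in> pverts T"
      using i assms(6) by (metis nth_mem)
    moreover have "parcs T `` set us \<subseteq> set us"
      using assms(6) in_arcsD2 by auto
    ultimately show "(?M *\<^sub>v ?x) $ i = (?c \<cdot>\<^sub>v unit_vec ?n 0) $ i"
      using i pencil_mat_mult_vec[OF assms(5) i, of T vertex_weight]
        vertex_weight_equation[of "us ! i"] by (simp add: unit_vec_def)
  qed (use M in simp)
  \<comment> \<open>At position (0, 0) the cofactor has sign +1 and equals the minor.\<close>
  from det_mult_eq_cofactor_mult[OF M _ n this]
  have "vertex_weight (us ! 0) * det ?M = ?c * det (mat_delete ?M 0 0)"
    using n by (simp add: cofactor_def)
  moreover have "mat_delete ?M 0 0 = map_mat to_fract (mat_delete (pencil_mat T us) 0 0)"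
    using pencil_mat_carrier[of T us] by (intro eq_matI) (auto simp: mat_delete_def)
  ultimately have "to_fract (psi T us) = ?c * to_fract (theta T us)"
    by (simp add: assms(7) vertex_weight_root psi_eq_det_pencil_mat theta_eq_det_mat_delete
        to_fract_hom.hom_det)
  then show ?thesis
    using theta F_nonzero r_ge_2 by auto
qed

end
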